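(* Let $N\ge1$, let $\mu_1,\dots,\mu_N$ be non-zero real numbers, $\alpha>0$, $\nu>0$, and let $\delta^{(\nu)}_k>0$, $\delta^{(\nu+1)}_k>0$ for $1\le k\le N$. Assume there are real coefficients $c^{(\nu)},d^{(\nu)}$ such that $$\delta^{(\nu+1)}_k=(d^{(\nu)}k+c^{(\nu)})\,\delta^{(\nu)}_k,\quad k=1,\dots,N,\qquad\text{and}\qquad \frac{\mu_{k+1}^2}{\mu_k^2}=d^{(\nu)}k(N-k)\frac{\delta^{(\nu)}_{k+1}}{\delta^{(\nu+1)}_k},\quad k=1,\dots,N-1.$$ Let $\Phi^{(\alpha,\nu)}$ and $\Psi^{(\alpha,\nu)}$ be the matrix valued polynomials determined by $$L^{(\alpha)}_\mu(0)^\ast\,\Phi^{(\alpha,\nu)}(x)\,(L^{(\alpha)}_\mu(0)^\ast)^{-1}=-d^{(\nu)}x^2A_\mu^\ast+x\bigl(d^{(\nu)}J+c^{(\nu)}\bigr),$$ $$L^{(\alpha)}_\mu(0)^\ast\,\Psi^{(\alpha,\nu)}(x)\,(L^{(\alpha)}_\mu(0)^\ast)^{-1}=x\Bigl(d^{(\nu)}\bigl(J-A_\mu^\ast(J+\nu+1)-N-1\bigr)-c^{(\nu)}\Bigr)+(\nu+J+1)(d^{(\nu)}J+c^{(\nu)})+(\Delta^{(\nu)})^{-1}A_\mu\Delta^{(\nu+1)}.$$ Then for all $x>0$ the Pearson equations $$\Phi^{(\alpha,\nu)}(x)=(W^{(\alpha,\nu)}_\mu(x))^{-1}W^{(\alpha,\nu+1)}_\mu(x),\qquad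 \Psi^{(\alpha,\nu)}(x)=(W^{(\alpha,\nu)}_\mu(x))^{-1}\frac{dW^{(\alpha,\nu+1)}_\mu}{dx}(x)$$ hold.
   Context: The Laguerre polynomials $L_n^{(a)}(x)$ are defined by $(1-t)^{-1-a}\exp\left(\frac{xt}{t-1}\right)=\sum_{n\ge0}L_n^{(a)}(x)t^n$. $L^{(\alpha)}_\mu(x)$ is the $N\times N$ unipotent lower triangular matrix polynomial with $L^{(\alpha)}_\mu(x)_{m,n}=\frac{\mu_m}{\mu_n}L^{(\alpha+n)}_{m-n}(x)$ for $m\ge n$ and $0$ for $m<n$. $A_\mu$ is the $N\times N$ matrix whose only non-zero entries are $(A_\mu)_{k,k-1}=-\mu_k/\mu_{k-1}$, $2\le k\le N$; $J=\mathrm{diag}(1,2,\dots,N)$; $\Delta^{(\nu)}=\mathrm{diag}(\delta^{(\nu)}_1,\dots,\delta^{(\nu)}_N)$. Scalars in matrix expressions denote multiples of the identity matrix. The weight is $W^{(\alpha,\nu)}_\mu(x)=L^{(\alpha)}_\mu(x)T^{(\nu)}(x)L^{(\alpha)}_\mu(x)^\ast$, $x>0$, where $T^{(\nu)}(x)$ is the diagonal matrix with $T^{(\nu)}(x)_{k,k}=e^{-x}x^{\nu+k}\delta^{(\nu)}_k$; $W^{(\alpha,\nu+1)}_\mu$ is the same expression with $\nu$ replaced by $\nu+1$ and $\delta^{(\nu)}_k$ by $\delta^{(\nu+1)}_k$. *)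

theory Defs
  imports
    Complex_Main
    "HOL-Computational_Algebra.Polynomial"
    "HOL-Computational_Algebra.Formal_Power_Series"
    "Jordan_Normal_Form.Gauss_Jordan_Elimination"
begin

(* The generating function (1-t)^(-1-a) * exp(x*t/(t-1)) as a formal power series in t.
   fps_binomial c is (1+t)^c, so composing with -t gives (1-t)^c; fps_exp x is exp(x*t). *)
definition laguerre_gf :: "real \<Rightarrow> real \<Rightarrow> real fps" where
  "laguerre_gf a x =
     fps_compose (fps_binomial (- 1 - a)) (- fps_X) *
     fps_compose (fps_exp x) (fps_X / (fps_X - 1))"

definition laguerre :: "real \<Rightarrow> nat \<Rightarrow> real \<Rightarrow> real" where
  "laguerre a n x = fps_nth (laguerre_gf a x) n"

(* Matrices of Jordan_Normal_Form are indexed from 0. In sqmat the entries are given by a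
   function of indices running through 1..N, and the parameter families \<mu> and \<delta> are likewise
   used at the indices 1..N only. *)
definition sqmat :: "nat \<Rightarrow> (nat \<Rightarrow> nat \<Rightarrow> real) \<Rightarrow> real mat" where
  "sqmat N f = mat N N (\<lambda>(i, j). f (Suc i) (Suc j))"

definition diagmat :: "nat \<Rightarrow> (nat \<Rightarrow> real) \<Rightarrow> real mat" where
  "diagmat N d = sqmat N (\<lambda>i j. if i = j then d i else 0)"

definition scalar_mat :: "nat \<Rightarrow> real \<Rightarrow> real mat" where
  "scalar_mat N c = c \<cdot>\<^sub>m 1\<^sub>m N"

(* Only meaningful for invertible A: otherwise mat_inverse A is None. *)
definition mat_inv :: "real mat \<Rightarrow> real mat" where
  "mat_inv A = the (mat_inverse A)"

definition laguerre_mat :: "nat \<Rightarrow> real \<Rightarrow> (nat \<Rightarrow> real) \<Rightarrow> real \<Rightarrow> real mat" where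
  "laguerre_mat N \<alpha> \<mu> x =
     sqmat N (\<lambda>m n. if n \<le> m then \<mu> m / \<mu> n * laguerre (\<alpha> + real n) (m - n) x else 0)"

definition A_mat :: "nat \<Rightarrow> (nat \<Rightarrow> real) \<Rightarrow> real mat" where
  "A_mat N \<mu> = sqmat N (\<lambda>k l. if k = l + 1 then - \<mu> k / \<mu> l else 0)"

definition J_mat :: "nat \<Rightarrow> real mat" where
  "J_mat N = diagmat N real"

definition T_mat :: "nat \<Rightarrow> real \<Rightarrow> (nat \<Rightarrow> real) \<Rightarrow> real \<Rightarrow> real mat" where
  "T_mat N \<nu> \<delta> x = diagmat N (\<lambda>k. exp (- x) * x powr (\<nu> + real k) * \<delta> k)"

(* All matrices are real, so the adjoint is the transpose. *)
definition weight ::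
  "nat \<Rightarrow> real \<Rightarrow> (nat \<Rightarrow> real) \<Rightarrow> real \<Rightarrow> (nat \<Rightarrow> real) \<Rightarrow> real \<Rightarrow> real mat" where
  "weight N \<alpha> \<mu> \<nu> \<delta> x =
     laguerre_mat N \<alpha> \<mu> x * T_mat N \<nu> \<delta> x * transpose_mat (laguerre_mat N \<alpha> \<mu> x)"

definition eval_poly_mat :: "real poly mat \<Rightarrow> real \<Rightarrow> real mat" where
  "eval_poly_mat P x = map_mat (\<lambda>p. poly p x) P"

definition has_mat_derivative :: "nat \<Rightarrow> (real \<Rightarrow> real mat) \<Rightarrow> real mat \<Rightarrow> real \<Rightarrow> bool" where
  "has_mat_derivative N F D x \<longleftrightarrow>
     (\<forall>t. F t \<in> carrier_mat N N) \<and> D \<in> carrier_mat N N \<and>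
     (\<forall>i<N. \<forall>j<N. ((\<lambda>t. F t $$ (i, j)) has_real_derivative D $$ (i, j)) (at x))"

end

theory Submission
  imports Defs "Jordan_Normal_Form.Determinant"
begin

text \<open>
  Expanding the generating function in powers of \<open>t / (t - 1)\<close> gives \<open>L(x) = L(0) exp (x A)\<close>, hence
  \<open>L' = L A\<close>. With \<open>M = exp (x A\<^sup>T)\<close>, so that \<open>L(x)\<^sup>T = M L(0)\<^sup>T\<close>, and \<open>F\<close> the conjugate of the
  polynomial \<open>X\<close> by \<open>L(0)\<^sup>T\<close>, a relation \<open>M F = G M\<close> yields \<open>W X = L (T G) L\<^sup>T\<close>. Since
  \<open>W' = L T' L\<^sup>T\<close> has derivative \<open>L (A T' + dT'/dx + T' A\<^sup>T) L\<^sup>T\<close>, where \<open>W'\<close> and \<open>T'\<close> belong to \<open>\<nu> + 1\<close>,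
  both Pearson equations come down to \<open>M F = G M\<close> for tridiagonal \<open>F\<close> and \<open>G\<close>. The condition on \<open>\<mu>\<close>
  makes the subdiagonal of \<open>\<Delta>\<^sup>-\<^sup>1 A \<Delta>'\<close> quadratic in the index, and the relation then holds entry by entry.
\<close>

section \<open>Laguerre polynomials: expansion around 0 and derivative\<close>

lemma fps_binomial_compose_add:
  "fps_compose (fps_binomial (a + b)) (- fps_X) =
     fps_compose (fps_binomial a) (- fps_X) * fps_compose (fps_binomial b) (- fps_X :: real fps)"
  by (simp add: fps_binomial_add_mult fps_compose_mult_distrib)

text \<open>Since t/(t-1) = -t (1-t)^(-1), a power contributes a sign, a shift by t^i and another
  binomial series, which merges with (1-t)^(-1-a) by adding exponents.\<close>

lemma fps_X_div_fps_X_minus_one_power: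
  "(fps_X / (fps_X - 1)) ^ i =
     fps_const ((-1) ^ i) * (fps_X ^ i * fps_compose (fps_binomial (- real i)) (- fps_X))"
proof -
  have "fps_X / (fps_X - 1 :: real fps) = fps_X * inverse (fps_X - 1)"
    by (simp add: fps_divide_unit)
  also have "inverse (fps_X - 1 :: real fps) = - inverse (1 - fps_X)"
    by (metis fps_inverse_minus minus_diff_eq)
  also have "inverse (1 - fps_X :: real fps) = fps_compose (fps_binomial (- 1)) (- fps_X)"
    by (simp add: fps_binomial_minus_one fps_inverse_compose fps_compose_add_distrib)
  finally have base: "fps_X / (fps_X - 1 :: real fps) =
      fps_const (-1) * (fps_X * fps_compose (fps_binomial (- 1)) (- fps_X))"
    by (simp flip: fps_const_neg)
  show ?thesis
  proof (induction i)
    case 0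
    show ?case by simp
  next
    case (Suc i)
    have binomial: "fps_compose (fps_binomial (- real (Suc i))) (- fps_X) =
        fps_compose (fps_binomial (- 1)) (- fps_X) * fps_compose (fps_binomial (- real i)) (- fps_X)"
      using fps_binomial_compose_add[of "- 1" "- real i"] by (simp add: algebra_simps)
    have "(fps_X / (fps_X - 1)) ^ Suc i = (fps_const (-1) * fps_const ((-1) ^ i)) *
        (fps_X ^ Suc i * (fps_compose (fps_binomial (- 1)) (- fps_X)
           * fps_compose (fps_binomial (- real i)) (- fps_X)))"
      unfolding power_Suc[of "fps_X / (fps_X - 1)"] Suc.IH unfolding base
      by (simp only: power_Suc mult_ac)
    then show ?case
      by (simp only: binomial fps_const_mult power_Suc)
  qed
qed

lemma laguerre_gf_at_0: "laguerre_gf a 0 = fps_compose (fps_binomial (- 1 - a)) (- fps_X)"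
  by (simp add: laguerre_gf_def)

text \<open>Expand exp(x y) at y = t/(t-1). The factor (1-t)^(-1-a) times y^j is (-1)^j t^j
  (1-t)^(-1-(a+j)), and the last factor is the generating function at 0 with parameter a+j.
  Parameter and degree move in opposite directions, just as the column index does in
  \<open>laguerre_mat\<close>.\<close>

lemma laguerre_expand:
  "laguerre a n x = (\<Sum>j\<le>n. (- x) ^ j / fact j * laguerre (a + real j) (n - j) 0)"
proof -
  let ?b = "fps_compose (fps_binomial (- 1 - a)) (- fps_X)" and ?y = "fps_X / (fps_X - 1) :: real fps"
  \<comment> \<open>The series y^j starts at t^j, so the inner sum over j may run up to n instead of
    n - i; only then can the two sums be swapped.\<close>
  have y_low: "fps_nth (?y ^ j) k = 0" if "k < j" for j k
    using that by (simp add: fps_X_div_fps_X_minus_one_power fps_X_power_mult_nth)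
  have coeff: "fps_nth (?b * ?y ^ j) n = (-1) ^ j * laguerre (a + real j) (n - j) 0" if "j \<le> n" for j
  proof -
    have "?b * ?y ^ j = fps_const ((-1) ^ j) * (fps_X ^ j * laguerre_gf (a + real j) 0)"
      using fps_binomial_compose_add[of "- 1 - a" "- real j"]
      by (simp add: fps_X_div_fps_X_minus_one_power laguerre_gf_at_0 mult_ac algebra_simps)
    then show ?thesis
      using that by (simp only: fps_mult_left_const_nth fps_X_power_mult_nth laguerre_def) simp
  qed
  have "laguerre a n x =
      (\<Sum>i=0..n. fps_nth ?b i * (\<Sum>j=0..n - i. x ^ j / fact j * fps_nth (?y ^ j) (n - i)))"
    by (simp add: laguerre_def laguerre_gf_def fps_mult_nth fps_compose_nth)
  also have "\<dots> =
      (\<Sum>i=0..n. fps_nth ?b i * (\<Sum>j=0..n. x ^ j / fact j * fps_nth (?y ^ j) (n - i)))"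
    by (intro sum.cong refl arg_cong2[of _ _ _ _ "(*)"] sum.mono_neutral_left) (auto simp: y_low)
  also have "\<dots> = (\<Sum>j=0..n. x ^ j / fact j * fps_nth (?b * ?y ^ j) n)"
    unfolding fps_mult_nth sum_distrib_left by (subst sum.swap) (simp add: mult_ac)
  also have "\<dots> = (\<Sum>j\<le>n. (- x) ^ j / fact j * laguerre (a + real j) (n - j) 0)"
    by (rule sum.cong) (auto simp: coeff power_minus[of x])
  finally show ?thesis .
qed

lemma laguerre_0 [simp]: "laguerre a 0 x = 1"
  by (simp add: laguerre_def laguerre_gf_def)

text \<open>Termwise differentiation of \<open>laguerre_expand\<close> kills j = 0, and shifting j
  by one gives the expansion for a+1 and n-1. The case n = 0 is separate because truncated
  subtraction would yield -1 there.\<close>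

lemma has_real_derivative_laguerre:
  "((\<lambda>x. laguerre a n x) has_real_derivative
      (if n = 0 then 0 else - laguerre (a + 1) (n - 1) x)) (at x)"
proof (cases n)
  case 0
  then show ?thesis by simp
next
  case (Suc m)
  have "((\<lambda>x. \<Sum>j\<le>n. (- x) ^ j / fact j * laguerre (a + real j) (n - j) 0) has_real_derivative
      (\<Sum>j\<le>n. (real j * (- x) ^ (j - 1) * (- 1)) / fact j * laguerre (a + real j) (n - j) 0)) (at x)"
    by (auto intro!: derivative_eq_intros sum.cong)
  also have "(\<Sum>j\<le>n. (real j * (- x) ^ (j - 1) * (- 1)) / fact j * laguerre (a + real j) (n - j) 0) =
      (\<Sum>j\<le>m. - ((- x) ^ j / fact j * laguerre (a + 1 + real j) (m - j) 0))"
    unfolding Suc sum.atMost_Suc_shift by (auto intro!: sum.cong simp: divide_simps) (auto simp: algebra_simps)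
  also have "\<dots> = - laguerre (a + 1) m x"
    by (simp add: laguerre_expand[of "a + 1"] sum_negf)
  finally show ?thesis
    unfolding laguerre_expand[of a n, symmetric] using Suc by simp
qed

section \<open>Inverse matrices and the conjugation argument\<close>

text \<open>A non-zero determinant makes A a unit of the matrix ring, so
  \<open>mat_inverse A\<close> is not \<open>None\<close> and \<open>the\<close> is
  harmless.\<close>

lemma mat_inv_inverse:
  assumes "A \<in> carrier_mat n n" "det A \<noteq> 0"
  shows "mat_inv A \<in> carrier_mat n n" "A * mat_inv A = 1\<^sub>m n" "mat_inv A * A = 1\<^sub>m n"
proof -
  obtain B where "mat_inverse A = Some B"
    using mat_inverse(1)[OF assms(1), of "()"] det_non_zero_imp_unit[OF assms, of "()"] by (cases "mat_inverse A") auto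
  then show "mat_inv A \<in> carrier_mat n n" "A * mat_inv A = 1\<^sub>m n" "mat_inv A * A = 1\<^sub>m n"
    using mat_inverse(2)[OF assms(1)] by (auto simp: mat_inv_def)
qed

lemma invertible_mat_if_det:
  assumes "A \<in> carrier_mat n n" "det A \<noteq> (0 :: real)"
  shows "invertible_mat A"
  unfolding invertible_mat_def
proof
  show "square_mat A" using assms(1) by auto
  show "\<exists>B. inverts_mat A B \<and> inverts_mat B A"
    using mat_inv_inverse[OF assms] assms(1) by (auto simp: inverts_mat_def)
qed

text \<open>Lets the Pearson equations be proved first in the inverse-free form
  \<open>W * X = B\<close>.\<close>

lemma mat_inv_mult_eqI:
  assumes "A \<in> carrier_mat n n" "det A \<noteq> 0" "X \<in> carrier_mat n n" "A * X = B"
  shows "X = mat_inv A * B"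
proof -
  have "mat_inv A * B = (mat_inv A * A) * X"
    using assms mat_inv_inverse(1)[OF assms(1,2)] by (simp flip: assms(4))
  then show ?thesis
    using assms(3) mat_inv_inverse(3)[OF assms(1,2)] by simp
qed

text \<open>Conjugation gives P X = F P, so L^T X = M P X = M F P = G M P = G L^T: multiplying L^T
  by X on the right amounts to multiplying it by G on the left, next to T.\<close>

lemma weight_mult_eq:
  assumes carr: "L \<in> carrier_mat n n" "T \<in> carrier_mat n n" "M \<in> carrier_mat n n"
      "P \<in> carrier_mat n n" "X \<in> carrier_mat n n" "G \<in> carrier_mat n n"
    and det: "det P \<noteq> 0"
    and L: "transpose_mat L = M * P"
    and F: "P * X * mat_inv P = F"
    and MF: "M * F = G * M"
  shows "L * T * transpose_mat L * X = L * (T * G) * transpose_mat L"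
proof -
  note inv = mat_inv_inverse[OF carr(4) det]
  have "F * P = P * X * (mat_inv P * P)"
    using carr inv(1) unfolding F[symmetric] by (intro assoc_mult_mat[of _ n n _ n _ n]) auto
  then have FP: "F * P = P * X"
    using carr inv by simp
  have Fc: "F \<in> carrier_mat n n"
    using carr inv(1) by (simp flip: F)
  have "transpose_mat L * X = M * (F * P)"
    using carr by (simp add: L FP)
  also have "\<dots> = G * transpose_mat L"
    using carr Fc by (simp add: L MF flip: assoc_mult_mat)
  finally have comm: "transpose_mat L * X = G * transpose_mat L" .
  have "L * T * transpose_mat L * X = L * T * (transpose_mat L * X)"
    using carr by (intro assoc_mult_mat[of _ n n _ n _ n]) auto
  also have "\<dots> = L * T * G * transpose_mat L"
    unfolding comm using carr by (intro assoc_mult_mat[of _ n n _ n _ n, symmetric]) auto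
  also have "L * T * G = L * (T * G)"
    using carr by (intro assoc_mult_mat[of _ n n _ n _ n]) auto
  finally show ?thesis .
qed

section \<open>Entrywise calculus for general, diagonal and tridiagonal matrices indexed from
  1\<close>

lemma sqmat_carrier [simp]: "sqmat N f \<in> carrier_mat N N"
  by (simp add: sqmat_def)

lemma diagmat_carrier [simp]: "diagmat N f \<in> carrier_mat N N"
  by (simp add: diagmat_def)

lemma sqmat_cong:
  assumes "\<And>i j. i \<in> {1..N} \<Longrightarrow> j \<in> {1..N} \<Longrightarrow> f i j = g i j"
  shows "sqmat N f = sqmat N g"
  using assms by (auto simp: sqmat_def intro!: eq_matI)

lemma sqmat_index [simp]: "i < N \<Longrightarrow> j < N \<Longrightarrow> sqmat N f $$ (i, j) = f (Suc i) (Suc j)"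
  by (simp add: sqmat_def)

lemma sqmat_mult: "sqmat N f * sqmat N g = sqmat N (\<lambda>i j. \<Sum>k\<in>{1..N}. f i k * g k j)"
proof (rule eq_matI)
  fix i j
  assume "i < dim_row (sqmat N (\<lambda>i j. \<Sum>k\<in>{1..N}. f i k * g k j))"
    and "j < dim_col (sqmat N (\<lambda>i j. \<Sum>k\<in>{1..N}. f i k * g k j))"
  then have "(sqmat N f * sqmat N g) $$ (i, j) = (\<Sum>k\<in>{0..<N}. f (Suc i) (Suc k) * g (Suc k) (Suc j))"
    by (simp add: sqmat_def scalar_prod_def)
  also have "\<dots> = (\<Sum>k\<in>{1..N}. f (Suc i) k * g k (Suc j))"
    by (rule sum.reindex_bij_witness[of _ "\<lambda>k. k - 1" Suc]) auto
  finally show "(sqmat N f * sqmat N g) $$ (i, j) =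
      sqmat N (\<lambda>i j. \<Sum>k\<in>{1..N}. f i k * g k j) $$ (i, j)"
    using \<open>i < _\<close> \<open>j < _\<close> by (simp add: sqmat_def)
qed (simp_all add: sqmat_def)

lemma sqmat_add: "sqmat N f + sqmat N g = sqmat N (\<lambda>i j. f i j + g i j)"
  by (auto simp: sqmat_def)

lemma sqmat_minus: "sqmat N f - sqmat N g = sqmat N (\<lambda>i j. f i j - g i j)"
  by (auto simp: sqmat_def)

lemma sqmat_smult: "a \<cdot>\<^sub>m sqmat N f = sqmat N (\<lambda>i j. a * f i j)"
  by (auto simp: sqmat_def)

lemma sqmat_transpose: "transpose_mat (sqmat N f) = sqmat N (\<lambda>i j. f j i)"
  by (auto simp: sqmat_def)

lemma scalar_mat_eq_diagmat: "scalar_mat N a = diagmat N (\<lambda>_. a)"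
  by (auto simp: sqmat_def scalar_mat_def diagmat_def)

lemma diagmat_add: "diagmat N f + diagmat N g = diagmat N (\<lambda>i. f i + g i)"
  unfolding diagmat_def sqmat_add by (auto intro!: sqmat_cong)

lemma diagmat_smult: "a \<cdot>\<^sub>m diagmat N f = diagmat N (\<lambda>i. a * f i)"
  unfolding diagmat_def sqmat_smult by (auto intro!: sqmat_cong)

lemma diagmat_mult_sqmat: "diagmat N f * sqmat N g = sqmat N (\<lambda>i j. f i * g i j)"
  unfolding diagmat_def sqmat_mult by (auto intro!: sqmat_cong simp: mult_delta_left)

lemma sqmat_mult_diagmat: "sqmat N g * diagmat N f = sqmat N (\<lambda>i j. g i j * f j)"
  unfolding diagmat_def sqmat_mult by (auto intro!: sqmat_cong simp: mult_delta_right)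

lemma diagmat_mult: "diagmat N f * diagmat N g = diagmat N (\<lambda>i. f i * g i)"
  unfolding diagmat_def[of N g] diagmat_mult_sqmat by (auto simp: diagmat_def intro!: sqmat_cong)

lemma det_diagmat: "det (diagmat N f) = (\<Prod>i\<in>{1..N}. f i)"
proof -
  have "det (diagmat N f) = prod_list (diag_mat (diagmat N f))"
    by (rule det_lower_triangular[of N]) (auto simp: diagmat_def)
  also have "\<dots> = (\<Prod>i\<in>{0..<N}. f (Suc i))"
    unfolding prod_list_diag_prod by (intro prod.cong) (auto simp: diagmat_def sqmat_def)
  also have "\<dots> = (\<Prod>i\<in>{1..N}. f i)"
    by (rule prod.reindex_bij_witness[of _ "\<lambda>k. k - 1" Suc]) auto
  finally show ?thesis .
qed

lemma mat_inv_diagmat: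
  assumes "\<And>i. i \<in> {1..N} \<Longrightarrow> f i \<noteq> 0"
  shows "mat_inv (diagmat N f) = diagmat N (\<lambda>i. 1 / f i)"
proof -
  have "diagmat N f * diagmat N (\<lambda>i. 1 / f i) = 1\<^sub>m N"
    using assms by (auto simp: diagmat_mult) (auto simp: diagmat_def sqmat_def)
  then have "diagmat N (\<lambda>i. 1 / f i) = mat_inv (diagmat N f) * 1\<^sub>m N"
    by (intro mat_inv_mult_eqI[of _ N]) (auto simp: det_diagmat assms)
  moreover have "mat_inv (diagmat N f) \<in> carrier_mat N N"
    by (rule mat_inv_inverse) (auto simp: det_diagmat assms)
  ultimately show ?thesis by simp
qed

text \<open>Subdiagonal entries are indexed by their column and superdiagonal entries by their row,
  so \<open>lo j\<close> and \<open>up j\<close> both link j with j+1 and transposition just swaps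
  \<open>lo\<close> and \<open>up\<close>.\<close>

definition tridiag :: "(nat \<Rightarrow> real) \<Rightarrow> (nat \<Rightarrow> real) \<Rightarrow> (nat \<Rightarrow> real) \<Rightarrow> nat \<Rightarrow> nat \<Rightarrow> real" where
  "tridiag lo dg up i j =
     (if i = j then dg j else if i = Suc j then lo j else if j = Suc i then up i else 0)"

lemma sum_tridiag:
  assumes "j \<in> {1..N}"
  shows "(\<Sum>k\<in>{1..N}. f k * tridiag lo dg up k j) =
     f j * dg j + (if j < N then f (Suc j) * lo j else 0)
       + (if 1 < j then f (j - 1) * up (j - 1) else 0)"
proof -
  have "(\<Sum>k\<in>{1..N}. f k * tridiag lo dg up k j) =
      (\<Sum>k\<in>{1..N}. (if k = j then f j * dg j else 0) + (if k = Suc j then f (Suc j) * lo j else 0)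
        + (if k = j - 1 then f (j - 1) * up (j - 1) else 0))"
    using assms by (intro sum.cong) (auto simp: tridiag_def)
  also have "\<dots> = f j * dg j + (if j < N then f (Suc j) * lo j else 0)
       + (if 1 < j then f (j - 1) * up (j - 1) else 0)"
    using assms by (auto simp: sum.distrib)
  finally show ?thesis .
qed

lemma sqmat_mult_tridiag:
  "sqmat N f * sqmat N (tridiag lo dg up) = sqmat N (\<lambda>i j.
     f i j * dg j + (if j < N then f i (Suc j) * lo j else 0)
       + (if 1 < j then f i (j - 1) * up (j - 1) else 0))"
  unfolding sqmat_mult by (intro sqmat_cong sum_tridiag)

lemma tridiag_mult_sqmat:
  "sqmat N (tridiag lo dg up) * sqmat N f = sqmat N (\<lambda>i j.
     dg i * f i j + (if i < N then up i * f (Suc i) j else 0)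
       + (if 1 < i then lo (i - 1) * f (i - 1) j else 0))"
proof -
  \<comment> \<open>Transposition turns the sum along a row into the sum along a column of
    \<open>sum_tridiag\<close>.\<close>
  have tr: "tridiag lo dg up i k = tridiag up dg lo k i" for i k
    by (auto simp: tridiag_def)
  show ?thesis
    unfolding sqmat_mult mult.commute[of "tridiag _ _ _ _ _"]
    by (intro sqmat_cong, subst tr, subst sum_tridiag) (auto simp: mult.commute)
qed


section \<open>Factorization of the Laguerre matrix and commutation with the exponential\<close>

lemma laguerre_mat_carrier [simp]: "laguerre_mat N \<alpha> \<mu> x \<in> carrier_mat N N"
  by (simp add: laguerre_mat_def)

lemma det_laguerre_mat:
  assumes "\<And>k. k \<in> {1..N} \<Longrightarrow> \<mu> k \<noteq> 0"
  shows "det (laguerre_mat N \<alpha> \<mu> x) = 1"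
proof -
  have "det (laguerre_mat N \<alpha> \<mu> x) = prod_list (diag_mat (laguerre_mat N \<alpha> \<mu> x))"
    by (rule det_lower_triangular[of N]) (auto simp: laguerre_mat_def)
  also have "\<dots> = 1"
    unfolding prod_list_diag_prod
    by (intro prod.neutral) (auto simp: laguerre_mat_def sqmat_def assms)
  finally show ?thesis .
qed

text \<open>The entries of exp(-x U), where U has ones on the superdiagonal and zeros elsewhere;
  this is exp(x A^T) with the \<open>\<mu>\<close> quotients stripped off.\<close>

definition exp_coeff :: "real \<Rightarrow> nat \<Rightarrow> nat \<Rightarrow> real" where
  "exp_coeff x i j = (if i \<le> j then (- x) ^ (j - i) / fact (j - i) else 0)"

text \<open>The recursion k e_k = -x e_(k-1) of the exponential series. Without division it also
  covers the zero entries: at i = j+1 the left factor vanishes.\<close>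

lemma exp_coeff_Suc: "(real j + 1 - real i) * exp_coeff x i (Suc j) = - x * exp_coeff x i j"
proof -
  consider k where "j = i + k" | "i = Suc j" | "i > Suc j"
    by (metis le_add_diff_inverse less_Suc_eq not_less nat_neq_iff Suc_lessI)
  then show ?thesis
    by cases (auto simp: exp_coeff_def divide_simps Suc_diff_le)
qed

lemma exp_coeff_Suc_Suc [simp]: "exp_coeff x (Suc i) (Suc j) = exp_coeff x i j"
  by (simp add: exp_coeff_def)

text \<open>The transpose of \<open>exp (x A)\<close>, where \<open>A\<close> is \<^const>\<open>A_mat\<close>.\<close>
definition exp_mat :: "nat \<Rightarrow> (nat \<Rightarrow> real) \<Rightarrow> real \<Rightarrow> real mat" where
  "exp_mat N \<mu> x = sqmat N (\<lambda>i j. \<mu> j / \<mu> i * exp_coeff x i j)"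

text \<open>This is \<open>laguerre_expand\<close> with summation index k - i: the shifted parameter
  is \<alpha> + k, the remaining degree is j - k, and the \<open>\<mu>\<close> quotients
  telescope.\<close>

lemma transpose_laguerre_mat:
  assumes "\<And>k. k \<in> {1..N} \<Longrightarrow> \<mu> k \<noteq> 0"
  shows "transpose_mat (laguerre_mat N \<alpha> \<mu> x) = exp_mat N \<mu> x * transpose_mat (laguerre_mat N \<alpha> \<mu> 0)"
proof -
  have "(if i \<le> j then \<mu> j / \<mu> i * laguerre (\<alpha> + real i) (j - i) x else 0) =
      (\<Sum>k\<in>{1..N}. \<mu> k / \<mu> i * exp_coeff x i k
         * (if k \<le> j then \<mu> j / \<mu> k * laguerre (\<alpha> + real k) (j - k) 0 else 0))"
    if ij: "i \<in> {1..N}" "j \<in> {1..N}" for i j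
  proof -
    have "(\<Sum>k\<in>{1..N}. \<mu> k / \<mu> i * exp_coeff x i k
         * (if k \<le> j then \<mu> j / \<mu> k * laguerre (\<alpha> + real k) (j - k) 0 else 0)) =
       (\<Sum>k\<in>{i..j}. \<mu> j / \<mu> i * (exp_coeff x i k * laguerre (\<alpha> + real k) (j - k) 0))"
      using ij assms by (intro sum.mono_neutral_cong_right) (auto simp: exp_coeff_def)
    also have "\<dots> = (if i \<le> j then \<mu> j / \<mu> i * laguerre (\<alpha> + real i) (j - i) x else 0)"
    proof (cases "i \<le> j")
      case True
      have "(\<Sum>k\<in>{i..j}. exp_coeff x i k * laguerre (\<alpha> + real k) (j - k) 0) =
          laguerre (\<alpha> + real i) (j - i) x"
        unfolding laguerre_expand[of "\<alpha> + real i"]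
        by (rule sum.reindex_bij_witness[of _ "\<lambda>k. k + i" "\<lambda>k. k - i"])
          (use True in \<open>auto simp: exp_coeff_def\<close>)
      then show ?thesis
        using True unfolding sum_distrib_left[symmetric] by simp
    qed simp
    finally show ?thesis by simp
  qed
  then show ?thesis
    unfolding laguerre_mat_def exp_mat_def sqmat_transpose sqmat_mult by (intro sqmat_cong) simp
qed

text \<open>
  Up to the factor \<open>\<mu> j / \<mu> i\<close>, the numbers \<open>u\<close>, \<open>v\<close>, \<open>w\<close> are the entries of \<^const>\<open>exp_mat\<close> at
  \<open>(i, j - 1)\<close>, \<open>(i, j)\<close>, \<open>(i, j + 1)\<close>; shifting \<open>i\<close> instead of \<open>j\<close> produces the same three.
\<close>
lemma exp_mat_comm_tridiag:
  assumes "\<And>k. k \<in> {1..N} \<Longrightarrow> \<mu> k \<noteq> 0"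
    and "\<And>i j u v w. i \<in> {1..N} \<Longrightarrow> j \<in> {1..N} \<Longrightarrow>
      x * u = (real i - real j) * v \<Longrightarrow> x * v = (real i - real j - 1) * w \<Longrightarrow>
      dg j * v + real j * (real N - real j) * l * w + up (j - 1) * u =
      dg' i * v + up' i * u + (real i - 1) * (real N - real i + 1) * l * w"
  shows "exp_mat N \<mu> x * sqmat N (tridiag (\<lambda>j. real j * (real N - real j) * l * \<mu> j / \<mu> (Suc j)) dg
             (\<lambda>i. up i * \<mu> (Suc i) / \<mu> i)) =
         sqmat N (tridiag (\<lambda>j. real j * (real N - real j) * l * \<mu> j / \<mu> (Suc j)) dg'
             (\<lambda>i. up' i * \<mu> (Suc i) / \<mu> i)) * exp_mat N \<mu> x"
  unfolding exp_mat_def sqmat_mult_tridiag tridiag_mult_sqmat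
proof (rule sqmat_cong)
  fix i j
  assume ij: "i \<in> {1..N}" "j \<in> {1..N}"
  obtain i' j' where Suc: "i = Suc i'" "j = Suc j'"
    using ij by (cases i; cases j) auto
  define u v w where "u = exp_coeff x i (j - 1)" and "v = exp_coeff x i j" and "w = exp_coeff x i (Suc j)"
  have "x * v = (real i - real j - 1) * w"
    using exp_coeff_Suc[of j i x] by (simp add: v_def w_def algebra_simps)
  moreover have "x * u = (real i - real j) * v"
    using exp_coeff_Suc[of "j - 1" i x] by (simp add: u_def v_def Suc algebra_simps)
  ultimately have "\<mu> j / \<mu> i * (dg j * v + real j * (real N - real j) * l * w + up (j - 1) * u) =
      \<mu> j / \<mu> i * (dg' i * v + up' i * u + (real i - 1) * (real N - real i + 1) * l * w)"
    using assms(2)[OF ij] by simp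
  moreover have "(if j < N then \<mu> (Suc j) / \<mu> i * exp_coeff x i (Suc j)
          * (real j * (real N - real j) * l * \<mu> j / \<mu> (Suc j)) else 0) =
      \<mu> j / \<mu> i * (real j * (real N - real j) * l * w)"
    using ij assms(1)[of "Suc j"] by (auto simp: w_def)
  moreover have "(if 1 < j then \<mu> (j - 1) / \<mu> i * exp_coeff x i (j - 1)
          * (up (j - 1) * \<mu> (Suc (j - 1)) / \<mu> (j - 1)) else 0) = \<mu> j / \<mu> i * (up (j - 1) * u)"
  proof (cases "1 < j")
    case True
    then show ?thesis using ij Suc assms(1)[of j'] by (auto simp: u_def)
  next
    case False
    then show ?thesis using ij by (auto simp: u_def exp_coeff_def)
  qed
  moreover have "(if i < N then up' i * \<mu> (Suc i) / \<mu> i * (\<mu> j / \<mu> (Suc i) * exp_coeff x (Suc i) j) else 0) =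
      \<mu> j / \<mu> i * (up' i * u)"
  proof (cases "i < N")
    case True
    then show ?thesis using Suc assms(1)[of "Suc i"] by (auto simp: u_def)
  next
    case False
    then show ?thesis using ij by (auto simp: u_def exp_coeff_def)
  qed
  moreover have "(if 1 < i then real (i - 1) * (real N - real (i - 1)) * l * \<mu> (i - 1) / \<mu> (Suc (i - 1))
          * (\<mu> j / \<mu> (i - 1) * exp_coeff x (i - 1) j) else 0) =
      \<mu> j / \<mu> i * ((real i - 1) * (real N - real i + 1) * l * w)"
  proof (cases "1 < i")
    case True
    then show ?thesis
      using ij Suc assms(1)[of i'] exp_coeff_Suc_Suc[of x "i - 1" j]
      by (auto simp: w_def of_nat_diff)
  next
    case False
    then show ?thesis using ij by auto
  qed
  ultimately show "\<mu> j / \<mu> i * exp_coeff x i j * dg j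
      + (if j < N then \<mu> (Suc j) / \<mu> i * exp_coeff x i (Suc j)
          * (real j * (real N - real j) * l * \<mu> j / \<mu> (Suc j)) else 0)
      + (if 1 < j then \<mu> (j - 1) / \<mu> i * exp_coeff x i (j - 1)
          * (up (j - 1) * \<mu> (Suc (j - 1)) / \<mu> (j - 1)) else 0) =
     dg' i * (\<mu> j / \<mu> i * exp_coeff x i j)
      + (if i < N then up' i * \<mu> (Suc i) / \<mu> i * (\<mu> j / \<mu> (Suc i) * exp_coeff x (Suc i) j) else 0)
      + (if 1 < i then real (i - 1) * (real N - real (i - 1)) * l * \<mu> (i - 1) / \<mu> (Suc (i - 1))
          * (\<mu> j / \<mu> (i - 1) * exp_coeff x (i - 1) j) else 0)"
    by (simp only: distrib_left v_def mult_ac add_ac)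
qed

section \<open>The derivative of the weight\<close>

lemma A_mat_eq_tridiag: "A_mat N \<mu> = sqmat N (tridiag (\<lambda>j. - \<mu> (Suc j) / \<mu> j) (\<lambda>_. 0) (\<lambda>_. 0))"
  by (auto simp: A_mat_def tridiag_def intro!: sqmat_cong)

lemma A_mat_carrier [simp]: "A_mat N \<mu> \<in> carrier_mat N N"
  by (simp add: A_mat_def)

text \<open>By \<open>has_real_derivative_laguerre\<close> the right side is the entrywise
  derivative of L, whence L' = L A. Each column of A has at most one non-zero entry, so
  multiplication by A moves column n+1 to column n, rescaled.\<close>

lemma laguerre_mat_mult_A_mat:
  assumes "\<And>k. k \<in> {1..N} \<Longrightarrow> \<mu> k \<noteq> 0"
  shows "laguerre_mat N \<alpha> \<mu> x * A_mat N \<mu> =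
    sqmat N (\<lambda>m n. if n < m then - \<mu> m / \<mu> n * laguerre (\<alpha> + real n + 1) (m - n - 1) x else 0)"
  unfolding laguerre_mat_def A_mat_eq_tridiag sqmat_mult_tridiag
  by (intro sqmat_cong) (use assms in \<open>auto simp: add_ac\<close>)

lemma sqmat_diagmat_sqmat_transpose:
  "sqmat N f * diagmat N t * transpose_mat (sqmat N g) =
     sqmat N (\<lambda>i j. \<Sum>k\<in>{1..N}. f i k * t k * g j k)"
  by (simp add: sqmat_mult_diagmat sqmat_transpose sqmat_mult)

text \<open>Regroups the product so that, with L A read as L', the summands are the three terms of
  the product rule.\<close>

lemma mult_sum3_mult_transpose:
  assumes carr: "(L :: real mat) \<in> carrier_mat n n" "A \<in> carrier_mat n n" "S \<in> carrier_mat n n" "T \<in> carrier_mat n n"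
  shows "L * (A * T + S + T * transpose_mat A) * transpose_mat L =
    (L * A) * T * transpose_mat L + L * S * transpose_mat L + L * T * transpose_mat (L * A)"
proof -
  have "L * (A * T + S + T * transpose_mat A) = L * (A * T) + L * S + L * (T * transpose_mat A)"
    using carr by (simp add: mult_add_distrib_mat[of _ n n _ n])
  then have "L * (A * T + S + T * transpose_mat A) * transpose_mat L =
      L * (A * T) * transpose_mat L + L * S * transpose_mat L + L * (T * transpose_mat A) * transpose_mat L"
    using carr by (simp add: add_mult_distrib_mat[of _ n n _ _ n])
  moreover have "L * (A * T) = (L * A) * T"
    using carr by (simp add: assoc_mult_mat[of _ n n _ n _ n])
  moreover have "L * (T * transpose_mat A) * transpose_mat L = L * T * transpose_mat (L * A)"
    using carr by (simp add: assoc_mult_mat[of _ n n _ n _ n] transpose_mult[of _ n n _ n])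
  ultimately show ?thesis by simp
qed

text \<open>The product rule is applied to the entries, which are sums over k of products of three
  functions; the matrix expression is expanded into the same sums. The diagonal matrix in the middle
  is dT/dx.\<close>

lemma has_mat_derivative_weight:
  fixes N :: nat and \<alpha> \<nu> x :: real and \<mu> \<delta> :: "nat \<Rightarrow> real"
  assumes "\<And>k. k \<in> {1..N} \<Longrightarrow> \<mu> k \<noteq> 0" and "x > 0"
  defines "L \<equiv> laguerre_mat N \<alpha> \<mu> x" and "A \<equiv> A_mat N \<mu>" and "T \<equiv> T_mat N \<nu> \<delta> x"
  shows "has_mat_derivative N (weight N \<alpha> \<mu> \<nu> \<delta>)
    (L * (A * T + diagmat N (\<lambda>k. exp (- x) * x powr (\<nu> + real k - 1) * (\<nu> + real k - x) * \<delta> k)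
       + T * transpose_mat A) * transpose_mat L) x"
proof -
  define f where "f y m n = (if n \<le> m then \<mu> m / \<mu> n * laguerre (\<alpha> + real n) (m - n) y else 0)" for y m n
  define f' where "f' m n =
    (if n < m then - \<mu> m / \<mu> n * laguerre (\<alpha> + real n + 1) (m - n - 1) x else 0)" for m n
  define t where "t y k = exp (- y) * y powr (\<nu> + real k) * \<delta> k" for y k
  define t' where "t' k = exp (- x) * x powr (\<nu> + real k - 1) * (\<nu> + real k - x) * \<delta> k" for k
  have f': "((\<lambda>y. f y m n) has_real_derivative f' m n) (at x)" for m n
    unfolding f_def f'_def
    using DERIV_cmult[OF has_real_derivative_laguerre[of "\<alpha> + real n" "m - n" x], of "\<mu> m / \<mu> n"]
    by (cases "n \<le> m") (auto split: if_splits)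
  have t': "((\<lambda>y. t y k) has_real_derivative t' k) (at x)" for k
  proof -
    have "x powr (\<nu> + real k) = x powr (\<nu> + real k - 1) * x"
      using \<open>x > 0\<close> by (simp add: powr_diff)
    then show ?thesis
      unfolding t_def t'_def using \<open>x > 0\<close>
      by (auto intro!: derivative_eq_intros simp: algebra_simps)
  qed
  have weight: "weight N \<alpha> \<mu> \<nu> \<delta> y = sqmat N (\<lambda>i j. \<Sum>k\<in>{1..N}. f y i k * t y k * f y j k)" for y
    unfolding weight_def laguerre_mat_def T_mat_def sqmat_diagmat_sqmat_transpose f_def t_def ..
  have LA: "L * A = sqmat N f'"
    unfolding L_def A_def f'_def using laguerre_mat_mult_A_mat assms(1) by blast
  have "L * (A * T + diagmat N t' + T * transpose_mat A) * transpose_mat L =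
      (L * A) * T * transpose_mat L + L * diagmat N t' * transpose_mat L + L * T * transpose_mat (L * A)"
    by (rule mult_sum3_mult_transpose[of _ N]) (auto simp: L_def A_def T_def T_mat_def)
  also have "\<dots> = sqmat N (\<lambda>i j. (\<Sum>k\<in>{1..N}. f' i k * t x k * f x j k)
       + (\<Sum>k\<in>{1..N}. f x i k * t' k * f x j k) + (\<Sum>k\<in>{1..N}. f x i k * t x k * f' j k))"
  proof -
    have "L = sqmat N (f x)" "T = diagmat N (t x)"
      by (simp_all add: L_def f_def[abs_def] laguerre_mat_def T_def t_def[abs_def] T_mat_def)
    then show ?thesis
      unfolding LA by (simp only: sqmat_diagmat_sqmat_transpose sqmat_add)
  qed
  finally have D: "L * (A * T + diagmat N t' + T * transpose_mat A) * transpose_mat L = \<dots>" .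
  have "has_mat_derivative N (weight N \<alpha> \<mu> \<nu> \<delta>)
      (L * (A * T + diagmat N t' + T * transpose_mat A) * transpose_mat L) x"
    unfolding has_mat_derivative_def D weight
    by (auto intro!: derivative_eq_intros f' t' simp: algebra_simps simp flip: sum.distrib)
  then show ?thesis
    unfolding t'_def[abs_def] .
qed

section \<open>The Pearson equations\<close>

theorem corollary5p3:
  fixes N :: nat and \<mu> \<delta> \<delta>' :: "nat \<Rightarrow> real" and \<alpha> \<nu> c d :: real
    and \<Phi> \<Psi> :: "real poly mat"
  assumes "N \<ge> 1"
    and "\<And>k. 1 \<le> k \<Longrightarrow> k \<le> N \<Longrightarrow> \<mu> k \<noteq> 0"
    and "\<alpha> > 0" and "\<nu> > 0"
    and "\<And>k. 1 \<le> k \<Longrightarrow> k \<le> N \<Longrightarrow> \<delta> k > 0"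
    and "\<And>k. 1 \<le> k \<Longrightarrow> k \<le> N \<Longrightarrow> \<delta>' k > 0"
    and "\<And>k. 1 \<le> k \<Longrightarrow> k \<le> N \<Longrightarrow> \<delta>' k = (d * real k + c) * \<delta> k"
    and "\<And>k. 1 \<le> k \<Longrightarrow> k \<le> N - 1 \<Longrightarrow>
           (\<mu> (k + 1))\<^sup>2 / (\<mu> k)\<^sup>2 = d * real k * (real N - real k) * (\<delta> (k + 1) / \<delta>' k)"
    and "\<Phi> \<in> carrier_mat N N" and "\<Psi> \<in> carrier_mat N N"
    and "\<And>x. transpose_mat (laguerre_mat N \<alpha> \<mu> 0) * eval_poly_mat \<Phi> x
               * mat_inv (transpose_mat (laguerre_mat N \<alpha> \<mu> 0))
             = (- d * x\<^sup>2) \<cdot>\<^sub>m transpose_mat (A_mat N \<mu>)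
               + x \<cdot>\<^sub>m (d \<cdot>\<^sub>m J_mat N + scalar_mat N c)"
    and "\<And>x. transpose_mat (laguerre_mat N \<alpha> \<mu> 0) * eval_poly_mat \<Psi> x
               * mat_inv (transpose_mat (laguerre_mat N \<alpha> \<mu> 0))
             = x \<cdot>\<^sub>m (d \<cdot>\<^sub>m (J_mat N
                           - transpose_mat (A_mat N \<mu>) * (J_mat N + scalar_mat N (\<nu> + 1))
                           - scalar_mat N (real N + 1))
                     - scalar_mat N c)
               + (J_mat N + scalar_mat N (\<nu> + 1)) * (d \<cdot>\<^sub>m J_mat N + scalar_mat N c)
               + mat_inv (diagmat N \<delta>) * A_mat N \<mu> * diagmat N \<delta>'"
  shows "\<forall>x>0. invertible_mat (weight N \<alpha> \<mu> \<nu> \<delta> x) \<and>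
           eval_poly_mat \<Phi> x
             = mat_inv (weight N \<alpha> \<mu> \<nu> \<delta> x) * weight N \<alpha> \<mu> (\<nu> + 1) \<delta>' x \<and>
           (\<exists>D. has_mat_derivative N (weight N \<alpha> \<mu> (\<nu> + 1) \<delta>') D x \<and>
                eval_poly_mat \<Psi> x = mat_inv (weight N \<alpha> \<mu> \<nu> \<delta> x) * D)"
proof (intro allI impI)
  fix x :: real
  assume x: "x > 0"
  have \<mu>: "\<mu> k \<noteq> 0" and \<delta>: "\<delta> k > 0" and \<delta>': "\<delta>' k = (d * real k + c) * \<delta> k" "\<delta>' k > 0"
    if "k \<in> {1..N}" for k
    using that assms(2,5,6,7) by auto
  \<comment> \<open>The left side is minus the subdiagonal of \<Delta>^(-1) A \<Delta>'. The
    condition on \<open>\<mu>\<close> brings it to the shape required by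
    \<open>exp_mat_comm_tridiag\<close>, with \<open>l\<close> = -d.\<close>
  have \<mu>_quot: "\<mu> (Suc k) / \<mu> k * \<delta>' k / \<delta> (Suc k) = real k * (real N - real k) * d * \<mu> k / \<mu> (Suc k)"
    if "k \<ge> 1" "Suc k \<le> N" for k
    using assms(8)[of k] \<mu>[of k] \<mu>[of "Suc k"] \<delta>[of "Suc k"] \<delta>'(2)[of k] that
    by (simp add: field_simps power2_eq_square)
  let ?L = "laguerre_mat N \<alpha> \<mu> x" and ?P = "transpose_mat (laguerre_mat N \<alpha> \<mu> 0)"
    and ?M = "exp_mat N \<mu> x" and ?T = "T_mat N \<nu> \<delta> x" and ?T' = "T_mat N (\<nu> + 1) \<delta>' x"
    and ?A = "A_mat N \<mu>" and ?W = "weight N \<alpha> \<mu> \<nu> \<delta> x"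
  have T: "?T \<in> carrier_mat N N" "?T' \<in> carrier_mat N N"
    by (simp_all add: T_mat_def)
  have M: "?M \<in> carrier_mat N N"
    by (simp add: exp_mat_def)
  have LM: "transpose_mat ?L = ?M * ?P"
    using transpose_laguerre_mat \<mu> by blast
  have detL: "det (laguerre_mat N \<alpha> \<mu> y) = 1" for y
    using det_laguerre_mat \<mu> by blast
  have detT: "det ?T \<noteq> 0"
    using x \<delta> by (fastforce simp: T_mat_def det_diagmat)
  have detP: "det ?P \<noteq> 0"
    by (simp add: det_transpose[of _ N] detL)
  have W: "?W \<in> carrier_mat N N"
    unfolding weight_def using T by (intro mult_carrier_mat[of _ N N]) auto
  have detW: "det ?W \<noteq> 0"
    using T detT mult_carrier_mat[OF laguerre_mat_carrier T(1)]
    by (simp add: weight_def det_mult[of _ N] det_transpose[of _ N] detL)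
  have eval: "eval_poly_mat \<Phi> x \<in> carrier_mat N N" "eval_poly_mat \<Psi> x \<in> carrier_mat N N"
    using assms(9,10) by (auto simp: eval_poly_mat_def)
  have powr: "x powr (\<nu> + 1 + real k) = x * x powr (\<nu> + real k)" for k
    using x by (simp add: powr_add)

  \<comment> \<open>\<open>G\<^sub>1\<close> is T^(-1) T', a diagonal matrix, and
    \<open>F\<^sub>1\<close> is the prescribed conjugate of \<open>\<Phi>\<close>. The vanishing
    coefficients are spelled out to fit the pattern of \<open>exp_mat_comm_tridiag\<close>.\<close>
  define G\<^sub>1 where "G\<^sub>1 = tridiag (\<lambda>j. real j * (real N - real j) * 0 * \<mu> j / \<mu> (Suc j))
      (\<lambda>i. x * (d * real i + c)) (\<lambda>i. 0 * \<mu> (Suc i) / \<mu> i)"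
  define F\<^sub>1 where "F\<^sub>1 = tridiag (\<lambda>j. real j * (real N - real j) * 0 * \<mu> j / \<mu> (Suc j))
      (\<lambda>i. x * (d * real i + c)) (\<lambda>i. d * x\<^sup>2 * \<mu> (Suc i) / \<mu> i)"
  have F\<^sub>1: "(- d * x\<^sup>2) \<cdot>\<^sub>m transpose_mat ?A + x \<cdot>\<^sub>m (d \<cdot>\<^sub>m J_mat N + scalar_mat N c) = sqmat N F\<^sub>1"
    unfolding A_mat_def J_mat_def scalar_mat_eq_diagmat diagmat_smult diagmat_add F\<^sub>1_def
    unfolding diagmat_def sqmat_transpose sqmat_smult sqmat_add
    by (intro sqmat_cong) (auto simp: tridiag_def)
  have "?M * sqmat N F\<^sub>1 = sqmat N G\<^sub>1 * ?M"
    unfolding F\<^sub>1_def G\<^sub>1_def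
  proof (rule exp_mat_comm_tridiag[OF \<mu>])
    fix i j u v w
    assume "x * u = (real i - real j) * v"
    \<comment> \<open>The factor d x turns the superdiagonal term d x^2 u into d x (i - j) v,
      exactly the difference of the two diagonal terms.\<close>
    then have "d * x * (x * u) = d * x * ((real i - real j) * v)"
      by simp
    then show "x * (d * real j + c) * v + real j * (real N - real j) * 0 * w + d * x\<^sup>2 * u =
      x * (d * real i + c) * v + 0 * u + (real i - 1) * (real N - real i + 1) * 0 * w"
      by (simp add: algebra_simps power2_eq_square)
  qed auto
  then have "?W * eval_poly_mat \<Phi> x = ?L * (?T * sqmat N G\<^sub>1) * transpose_mat ?L"
    unfolding weight_def
    by (intro weight_mult_eq[where P = ?P and M = ?M, OF _ _ _ _ _ _ detP])
      (use T eval assms(11)[of x] F\<^sub>1 in \<open>auto simp: M LM\<close>)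
  moreover have "?T * sqmat N G\<^sub>1 = ?T'"
    unfolding T_mat_def diagmat_mult_sqmat G\<^sub>1_def
    by (auto simp: diagmat_def tridiag_def \<delta>' powr intro!: sqmat_cong)
  ultimately have \<Phi>: "?W * eval_poly_mat \<Phi> x = weight N \<alpha> \<mu> (\<nu> + 1) \<delta>' x"
    by (simp add: weight_def)

  \<comment> \<open>\<open>G\<^sub>2\<close> is T^(-1) (A T' + dT'/dx + T' A^T). In its subdiagonal
    the powers of x cancel, leaving the same entries as in \<open>F\<^sub>2\<close>.\<close>
  define G\<^sub>2 where "G\<^sub>2 = tridiag (\<lambda>j. real j * (real N - real j) * (- d) * \<mu> j / \<mu> (Suc j))
      (\<lambda>i. (d * real i + c) * (\<nu> + 1 + real i - x)) (\<lambda>i. - x * (d * real i + c) * \<mu> (Suc i) / \<mu> i)"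
  \<comment> \<open>The superdiagonal contains \<open>Suc i\<close> because J stands to the right of
    A^T and scales by the column index.\<close>
  define F\<^sub>2 where "F\<^sub>2 = tridiag (\<lambda>j. real j * (real N - real j) * (- d) * \<mu> j / \<mu> (Suc j))
      (\<lambda>i. x * (d * (real i - real N - 1) - c) + (\<nu> + real i + 1) * (d * real i + c))
      (\<lambda>i. x * d * (\<nu> + real (Suc i) + 1) * \<mu> (Suc i) / \<mu> i)"
  have F\<^sub>2: "x \<cdot>\<^sub>m (d \<cdot>\<^sub>m (J_mat N - transpose_mat ?A * (J_mat N + scalar_mat N (\<nu> + 1))
                  - scalar_mat N (real N + 1)) - scalar_mat N c)
        + (J_mat N + scalar_mat N (\<nu> + 1)) * (d \<cdot>\<^sub>m J_mat N + scalar_mat N c)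
        + mat_inv (diagmat N \<delta>) * ?A * diagmat N \<delta>' = sqmat N F\<^sub>2"
  proof -
    have inv: "mat_inv (diagmat N \<delta>) = diagmat N (\<lambda>i. 1 / \<delta> i)"
      using \<delta> by (intro mat_inv_diagmat) force
    show ?thesis
      unfolding inv A_mat_def J_mat_def scalar_mat_eq_diagmat diagmat_smult diagmat_add diagmat_mult
        sqmat_transpose diagmat_mult_sqmat sqmat_mult_diagmat F\<^sub>2_def
      unfolding diagmat_def sqmat_smult sqmat_add sqmat_minus
    proof (intro sqmat_cong)
      fix i j
      assume ij: "i \<in> {1..N}" "j \<in> {1..N}"
      show "x * (d * ((if i = j then real i else 0)
              - (if j = i + 1 then - \<mu> j / \<mu> i else 0) * (real j + (\<nu> + 1))
              - (if i = j then real N + 1 else 0)) - (if i = j then c else 0))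
            + (if i = j then (real i + (\<nu> + 1)) * (d * real i + c) else 0)
            + 1 / \<delta> i * (if i = j + 1 then - \<mu> i / \<mu> j else 0) * \<delta>' j =
          tridiag (\<lambda>j. real j * (real N - real j) * - d * \<mu> j / \<mu> (Suc j))
            (\<lambda>i. x * (d * (real i - real N - 1) - c) + (\<nu> + real i + 1) * (d * real i + c))
            (\<lambda>i. x * d * (\<nu> + real (Suc i) + 1) * \<mu> (Suc i) / \<mu> i) i j"
      proof (cases "i = Suc j")
        case True
        then show ?thesis
          using ij \<mu>_quot[of j] by (simp add: tridiag_def mult_ac)
      next
        case False
        then show ?thesis
          using ij by (auto simp: tridiag_def algebra_simps add_divide_distrib)
      qed
    qed
  qed
  have "?M * sqmat N F\<^sub>2 = sqmat N G\<^sub>2 * ?M"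
    unfolding F\<^sub>2_def G\<^sub>2_def
  proof (rule exp_mat_comm_tridiag[OF \<mu>])
    fix i j u v w
    assume "j \<in> {1..N}" and uv: "x * u = (real i - real j) * v" "x * v = (real i - real j - 1) * w"
    \<comment> \<open>The first multiplier collects the coefficients of x u from both sides of the
      goal. The second comes from (i-1)(N-i+1) - j(N-j) = -(i-j-1)(i+j-N-1): the difference of the w
      terms contains the factor i-j-1 that converts w into x v.\<close>
    have "(d * (real j + \<nu> + 1) + d * real i + c) * (x * u) =
        (d * (real j + \<nu> + 1) + d * real i + c) * ((real i - real j) * v)"
      "d * (real i + real j - real N - 1) * (x * v) =
        d * (real i + real j - real N - 1) * ((real i - real j - 1) * w)"
      using uv by simp_all
    moreover have "real (Suc (j - 1)) = real j"
      using \<open>j \<in> {1..N}\<close> by simp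
    ultimately show "(x * (d * (real j - real N - 1) - c) + (\<nu> + real j + 1) * (d * real j + c)) * v
        + real j * (real N - real j) * (- d) * w + x * d * (\<nu> + real (Suc (j - 1)) + 1) * u =
      (d * real i + c) * (\<nu> + 1 + real i - x) * v + - x * (d * real i + c) * u
        + (real i - 1) * (real N - real i + 1) * (- d) * w"
      by (simp add: algebra_simps)
  qed auto
  then have "?W * eval_poly_mat \<Psi> x = ?L * (?T * sqmat N G\<^sub>2) * transpose_mat ?L"
    unfolding weight_def
    by (intro weight_mult_eq[where P = ?P and M = ?M, OF _ _ _ _ _ _ detP])
      (use T eval assms(12)[of x] F\<^sub>2 in \<open>auto simp: M LM\<close>)
  \<comment> \<open>The middle factor of the derivative of the weight for \<nu> + 1, left
    unsimplified so that \<open>has_mat_derivative_weight\<close> applies literally.\<close>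
  moreover define S where "S = ?A * ?T'
      + diagmat N (\<lambda>k. exp (- x) * x powr (\<nu> + 1 + real k - 1) * (\<nu> + 1 + real k - x) * \<delta>' k)
      + ?T' * transpose_mat ?A"
  moreover have "?T * sqmat N G\<^sub>2 = S"
    unfolding S_def A_mat_def T_mat_def sqmat_transpose diagmat_mult_sqmat sqmat_mult_diagmat
    unfolding diagmat_def sqmat_add G\<^sub>2_def
  proof (intro sqmat_cong)
    fix i j
    assume ij: "i \<in> {1..N}" "j \<in> {1..N}"
    \<comment> \<open>Only the subdiagonal needs the condition on \<open>\<mu>\<close>; there i =
      j+1, so x^(\<nu>+i) on the left equals x^(\<nu>+1+j) on the right.\<close>
    have "real j * (real N - real j) * - d * \<mu> j / \<mu> i * \<delta> i = - \<mu> i / \<mu> j * \<delta>' j" if "i = Suc j"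
    proof -
      have "real j * (real N - real j) * - d * \<mu> j / \<mu> i * \<delta> i =
          - (real j * (real N - real j) * d * \<mu> j / \<mu> (Suc j)) * \<delta> (Suc j)"
        using that by simp
      also have "\<dots> = - \<mu> i / \<mu> j * \<delta>' j"
        using \<mu>_quot[of j, symmetric] ij that \<delta>[of i] by simp
      finally show ?thesis .
    qed
    then have step: "exp (- x) * x powr (\<nu> + real i) * (real j * (real N - real j) * - d * \<mu> j / \<mu> i * \<delta> i) =
        exp (- x) * x powr (\<nu> + real i) * (- \<mu> i / \<mu> j * \<delta>' j)" if "i = Suc j"
      using that by simp
    show "exp (- x) * x powr (\<nu> + real i) * \<delta> i *
        tridiag (\<lambda>j. real j * (real N - real j) * (- d) * \<mu> j / \<mu> (Suc j))
          (\<lambda>i. (d * real i + c) * (\<nu> + 1 + real i - x)) (\<lambda>i. - x * (d * real i + c) * \<mu> (Suc i) / \<mu> i) i j =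
        (if i = j + 1 then - \<mu> i / \<mu> j else 0) * (exp (- x) * x powr (\<nu> + 1 + real j) * \<delta>' j)
        + (if i = j then exp (- x) * x powr (\<nu> + 1 + real i - 1) * (\<nu> + 1 + real i - x) * \<delta>' i else 0)
        + exp (- x) * x powr (\<nu> + 1 + real i) * \<delta>' i * (if j = i + 1 then - \<mu> j / \<mu> i else 0)"
    proof (cases "i = Suc j")
      case True
      then show ?thesis
        using step by (simp add: tridiag_def add_ac mult_ac)
    next
      case False
      then show ?thesis
        using ij \<delta>'(1)[of i] powr by (auto simp: tridiag_def add_ac mult_ac)
    qed
  qed
  ultimately have \<Psi>: "?W * eval_poly_mat \<Psi> x = ?L * S * transpose_mat ?L"
    by simp
  have "has_mat_derivative N (weight N \<alpha> \<mu> (\<nu> + 1) \<delta>') (?L * S * transpose_mat ?L) x"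
    unfolding S_def by (rule has_mat_derivative_weight[OF \<mu> x])
  then show "invertible_mat ?W \<and>
      eval_poly_mat \<Phi> x = mat_inv ?W * weight N \<alpha> \<mu> (\<nu> + 1) \<delta>' x \<and>
      (\<exists>D. has_mat_derivative N (weight N \<alpha> \<mu> (\<nu> + 1) \<delta>') D x \<and> eval_poly_mat \<Psi> x = mat_inv ?W * D)"
    using invertible_mat_if_det[OF W detW] mat_inv_mult_eqI[OF W detW eval(1) \<Phi>]
      mat_inv_mult_eqI[OF W detW eval(2) \<Psi>] by blast
qed

end
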